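(* Let $(x_n)_{n\ge1}$ be the van der Corput sequence in base 2. Then $$\limsup_{N\to\infty}\frac1{N^2}\prod_{n=1}^N|2\sin(\pi x_n)|=\frac1{2\pi}$$ and $$\liminf_{N\to\infty}\prod_{n=1}^N|2\sin(\pi x_n)|=\pi.$$
   Context: The van der Corput sequence in base 2 is defined as follows: for $n\in\mathbb N$, $n\ge 1$, with (finite) binary expansion $n=a_0+a_12+a_22^2+\cdots$, digits $a_i\in\{0,1\}$, put $x_n=\frac{a_0}{2}+\frac{a_1}{2^2}+\frac{a_2}{2^3}+\cdots$. *)

theory Defs
  imports "HOL-Analysis.Analysis"
begin

(* bit n i is the digit a_i of n; only finitely many terms of the series are nonzero. *)
definition van_der_corput :: "nat \<Rightarrow> real" where
  "van_der_corput n = (\<Sum>i. of_bool (bit n i) / 2 ^ Suc i)"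

lemma binary_expansion_nat: "n = (\<Sum>i<n. of_bool (bit n i) * 2 ^ i)" for n :: nat
proof -
  have "(\<Sum>i<n. of_bool (bit n i) * 2 ^ i) = take_bit n n"
    by (simp add: horner_sum_bit_eq_take_bit [symmetric] horner_sum_eq_sum lessThan_atLeast0)
  also have "\<dots> = n"
    by (simp add: take_bit_nat_eq_self)
  finally show ?thesis by simp
qed

lemma van_der_corput_finite_sum:
  "van_der_corput n = (\<Sum>i<n. of_bool (bit n i) / 2 ^ Suc i)"
proof -
  have "\<not> bit n i" if "i \<ge> n" for i
  proof -
    have "n < 2 ^ i"
      using that less_exp [of i] by linarith
    then show ?thesis by (simp add: bit_iff_odd)
  qed
  then show ?thesis
    unfolding van_der_corput_def by (intro suminf_finite) auto
qed

end

(*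
  Let Q(M) be the product over 0 < n < M and x the van der Corput sequence. Since
  x(2n) = x(n)/2 and x(2n+1) = (1 + x(n))/2, the duplication formula for the sine gives
  Q(2M) = 2 Q(M) and Q(2M+1) = 4 Q(M) sin(pi x(M) / 2) for M >= 1.

  Liminf: Q(M) x(M) is unchanged under M -> 2M and at least doubles under M -> 2M+1, because
  sin(pi x / 2) >= x on [0,1]. Hence Q(M) >= 4 for M >= 3, unless M = 2^a + 1, where Q(M)
  tends to pi.

  Limsup: Q(M) / M^2 is halved by M -> 2M and does not increase under M -> 2M+1. As
  Q(3) / 9 <= 1 / pi, each branch of the binary tree that leaves the path 3, 7, 15, ... satisfies
  Q(M) / M^2 <= 1 / (2 pi) from then on, and a few small cases settle the branch of M = 2. On
  the path M = 2^m - 1 itself Q(M) = 2^m / (2 sin(pi / 2^m)).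
*)
theory Submission
  imports Defs "HOL-Real_Asymp.Real_Asymp"
begin

section \<open>Binary recursion of the van der Corput sequence\<close>

lemma summable_van_der_corput: "summable (\<lambda>i. of_bool (bit n i) / 2 ^ Suc i :: real)" for n :: nat
proof (rule summable_comparison_test')
  show "summable (\<lambda>i. (1 / 2) ^ i :: real)"
    by (simp add: summable_geometric)
qed (simp add: power_one_over field_simps)

text \<open>The lowest binary digit gives the first term of the series; the digits of
  \<open>m div 2\<close> follow, shifted by one place and hence halved.\<close>

lemma van_der_corput_Suc_double: "van_der_corput (Suc (2 * n)) = (1 + van_der_corput n) / 2"
  and van_der_corput_double: "van_der_corput (2 * n) = van_der_corput n / 2"
proof -
  have head: "van_der_corput m
      = of_bool (odd m) / 2 + (\<Sum>i. of_bool (bit (m div 2) i) / 2 ^ Suc i / 2)" for m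
    using suminf_split_head[OF summable_van_der_corput, of m]
    by (simp add: van_der_corput_def bit_Suc bit_0 field_simps)
  have half: "(\<Sum>i. of_bool (bit n i) / 2 ^ Suc i / 2) = van_der_corput n / 2"
    unfolding van_der_corput_def by (rule suminf_divide[OF summable_van_der_corput])
  show "van_der_corput (Suc (2 * n)) = (1 + van_der_corput n) / 2"
    using head[of "Suc (2 * n)"] half by simp
  show "van_der_corput (2 * n) = van_der_corput n / 2"
    using head[of "2 * n"] half by simp
qed

lemma van_der_corput_0: "van_der_corput 0 = 0"
  using van_der_corput_double[of 0] by simp

lemma van_der_corput_1: "van_der_corput (Suc 0) = 1 / 2"
  using van_der_corput_Suc_double[of 0] by (simp add: van_der_corput_0)

lemma van_der_corput_bounds: "0 \<le> van_der_corput n \<and> van_der_corput n < 1"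
  by (induction n rule: nat_bit_induct)
    (auto simp: van_der_corput_0 van_der_corput_double van_der_corput_Suc_double)

lemma van_der_corput_nonneg: "0 \<le> van_der_corput n"
  and van_der_corput_less_1: "van_der_corput n < 1"
  using van_der_corput_bounds by auto

lemma van_der_corput_pow2: "van_der_corput (2 ^ a) = 1 / 2 ^ Suc a"
  by (induction a) (simp_all add: van_der_corput_1 van_der_corput_double)

lemma pow2_Suc_minus_1: "(2::nat) ^ Suc m - 1 = Suc (2 * (2 ^ m - 1))"
  by (cases "(2::nat) ^ m") simp_all

lemma van_der_corput_pow2_minus_1: "van_der_corput (2 ^ m - 1) = 1 - 1 / 2 ^ m"
proof (induction m)
  case (Suc m)
  then show ?case
    by (simp only: pow2_Suc_minus_1 van_der_corput_Suc_double) (simp add: field_simps)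
qed (simp add: van_der_corput_0)

section \<open>The sine product and its duplication rules\<close>

text \<open>The range stops before \<open>M\<close>, so that the product up to N is
  \<open>sine_prod (Suc N)\<close>. This makes the doubling rule exact: the indices below
  \<open>2 * M\<close> are 1 and the pairs 2n, 2n+1 with 0 < n < M.\<close>

definition sine_prod :: "nat \<Rightarrow> real" where
  "sine_prod M = (\<Prod>n\<in>{1..<M}. \<bar>2 * sin (pi * van_der_corput n)\<bar>)"

lemma sine_prod_nonneg: "0 \<le> sine_prod M"
  by (simp add: sine_prod_def prod_nonneg)

lemma sine_prod_1: "sine_prod (Suc 0) = 1"
  by (simp add: sine_prod_def)

lemma sine_prod_Suc:
  "M \<ge> 1 \<Longrightarrow> sine_prod (Suc M) = sine_prod M * (2 * sin (pi * van_der_corput M))"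
proof -
  assume "M \<ge> 1"
  moreover have "pi * van_der_corput M \<le> pi"
    using van_der_corput_less_1[of M] by simp
  then have "0 \<le> sin (pi * van_der_corput M)"
    by (intro sin_ge_zero) (simp_all add: van_der_corput_nonneg)
  ultimately show ?thesis
    by (simp add: sine_prod_def)
qed

text \<open>The factors at 2n and 2n+1 are 2 sin y and 2 cos y with y = pi x(n) / 2, and their
  product 2 sin(2y) is the factor at n. The leftover index 1 contributes 2.\<close>

lemma sine_prod_double: "M \<ge> 1 \<Longrightarrow> sine_prod (2 * M) = 2 * sine_prod M"
proof (induction M rule: nat_induct_at_least)
  case base
  have "2 * (1::nat) = Suc (Suc 0)" by simp
  then show ?case
    by (simp only: sine_prod_Suc) (simp add: sine_prod_1 van_der_corput_1)
next
  case (Suc M)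
  let ?y = "pi * van_der_corput M / 2"
  have "sine_prod (2 * Suc M)
      = sine_prod (2 * M) * (2 * sin ?y) * (2 * sin (pi / 2 + ?y))"
    using Suc.hyps
    by (simp add: sine_prod_Suc van_der_corput_double van_der_corput_Suc_double distrib_left
        add_divide_distrib)
  also have "sin (pi / 2 + ?y) = cos ?y"
    by (simp add: sin_add)
  also have "sine_prod (2 * M) * (2 * sin ?y) * (2 * cos ?y)
      = sine_prod (2 * M) * (2 * sin (2 * ?y))"
    by (simp only: sin_double)
  finally show ?case
    using Suc by (simp add: sine_prod_Suc)
qed

lemma sine_prod_Suc_double:
  "M \<ge> 1 \<Longrightarrow> sine_prod (Suc (2 * M)) = 4 * sine_prod M * sin (pi * van_der_corput M / 2)"
  by (simp add: sine_prod_Suc sine_prod_double van_der_corput_double)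

lemma sine_prod_pow2: "sine_prod (2 ^ a) = 2 ^ a"
  by (induction a) (simp_all add: sine_prod_1 sine_prod_double)

lemma sine_prod_pow2_plus_1: "sine_prod (Suc (2 ^ a)) = 2 ^ a * (2 * sin (pi / (2 * 2 ^ a)))"
  by (simp add: sine_prod_Suc sine_prod_pow2 van_der_corput_pow2)

text \<open>Divide Q(2^m) = 2^m by its last factor, which is 2 sin(pi / 2^m) by the symmetry of the
  sine about pi/2.\<close>

lemma sine_prod_pow2_minus_1:
  assumes "m \<ge> 1"
  shows "sine_prod (2 ^ m - 1) = 2 ^ m / (2 * sin (pi / 2 ^ m))"
proof -
  have "(2::nat) ^ 1 \<le> 2 ^ m"
    using assms by (intro power_increasing) auto
  then have "(2::nat) ^ m - 1 \<ge> 1" by simp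
  from sine_prod_Suc[OF this]
  have "2 ^ m = sine_prod (2 ^ m - 1) * (2 * sin (pi * (1 - 1 / 2 ^ m)))"
    by (simp add: sine_prod_pow2 van_der_corput_pow2_minus_1[unfolded One_nat_def])
  also have "sin (pi * (1 - 1 / 2 ^ m)) = sin (pi / 2 ^ m)"
    by (simp add: right_diff_distrib sin_diff)
  finally have eq: "2 ^ m = sine_prod (2 ^ m - 1) * (2 * sin (pi / 2 ^ m))" .
  then have "sin (pi / 2 ^ m) \<noteq> 0"
    by (metis mult_zero_right power_not_zero zero_neq_numeral)
  with eq show ?thesis
    by (simp add: field_simps)
qed

section \<open>The lower limit\<close>

text \<open>By concavity the sine lies above its chord from 0 to pi/2.\<close>

lemma le_sin_pi_half:
  assumes "0 \<le> x" "x \<le> 1"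
  shows "x \<le> sin (pi * x / 2)"
proof -
  have "concave_on {0..pi} sin"
    by (rule f''_le0_imp_concave[where f' = cos and f'' = "\<lambda>x. - sin x"])
      (auto intro!: derivative_eq_intros sin_ge_zero)
  then have "(1 - x) * sin 0 + x * sin (pi / 2) \<le> sin ((1 - x) *\<^sub>R 0 + x *\<^sub>R (pi / 2))"
    using assms by (intro concave_onD) auto
  then show ?thesis
    by (simp add: mult.commute)
qed

lemma sine_prod_Suc_double_ge:
  assumes "M \<ge> 1"
  shows "4 * (sine_prod M * van_der_corput M) \<le> sine_prod (Suc (2 * M))"
proof -
  have "van_der_corput M \<le> sin (pi * van_der_corput M / 2)"
    using van_der_corput_bounds[of M] by (intro le_sin_pi_half) auto
  then show ?thesis
    using assms by (simp add: sine_prod_Suc_double mult_left_mono sine_prod_nonneg)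
qed

lemma sine_prod_times_van_der_corput_Suc_double:
  assumes "M \<ge> 1"
  shows "2 * (sine_prod M * van_der_corput M)
           \<le> sine_prod (Suc (2 * M)) * van_der_corput (Suc (2 * M))"
proof -
  \<comment> \<open>The factor 1/2 bounds x(2M+1) = (1 + x(M)) / 2 from below.\<close>
  have "4 * (sine_prod M * van_der_corput M) * (1 / 2)
      \<le> sine_prod (Suc (2 * M)) * van_der_corput (Suc (2 * M))"
    using sine_prod_Suc_double_ge[OF assms] van_der_corput_nonneg[of M]
    by (intro mult_mono) (auto simp: sine_prod_nonneg van_der_corput_Suc_double)
  then show ?thesis by linarith
qed

lemma sine_prod_times_van_der_corput_ge_half:
  "M \<ge> 1 \<Longrightarrow> 1 / 2 \<le> sine_prod M * van_der_corput M"
proof (induction M rule: nat_bit_induct)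
  case (even n)
  then show ?case by (simp add: sine_prod_double van_der_corput_double)
next
  case (odd n)
  show ?case
  proof (cases "n = 0")
    case False
    then show ?thesis
      using odd sine_prod_times_van_der_corput_Suc_double[of n] by simp
  qed (simp add: sine_prod_1 van_der_corput_1)
qed simp

text \<open>Powers of two keep the starting value 1/2. Any other index has an odd step from some n
  >= 1, which lifts 1/2 to 1, and later even steps preserve the bound.\<close>

lemma sine_prod_times_van_der_corput_ge_1:
  "M \<ge> 1 \<Longrightarrow> (\<exists>a. M = 2 ^ a) \<or> 1 \<le> sine_prod M * van_der_corput M"
proof (induction M rule: nat_bit_induct)
  case (even n)
  then have "(\<exists>a. n = 2 ^ a) \<or> 1 \<le> sine_prod n * van_der_corput n" by simp
  then show ?case
  proof
    assume "\<exists>a. n = 2 ^ a"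
    then show ?thesis by (metis power_Suc)
  next
    assume "1 \<le> sine_prod n * van_der_corput n"
    then show ?thesis
      using even by (simp add: sine_prod_double van_der_corput_double)
  qed
next
  case (odd n)
  show ?case
  proof (cases "n = 0")
    case True
    then show ?thesis by (auto intro: exI[of _ 0])
  next
    case False
    then have "n \<ge> 1" by simp
    then show ?thesis
      using sine_prod_times_van_der_corput_Suc_double[of n]
        sine_prod_times_van_der_corput_ge_half[of n] by linarith
  qed
qed simp

lemma sine_prod_ge_2: "M \<ge> 2 \<Longrightarrow> 2 \<le> sine_prod M"
proof (induction M rule: nat_bit_induct)
  case (even n)
  show ?case
  proof (cases "n = 1")
    case True
    then show ?thesis using sine_prod_double[of 1] sine_prod_1 by simp
  next
    case False
    then show ?thesis using even by (simp add: sine_prod_double)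
  qed
next
  case (odd n)
  then have "n \<ge> 1" by simp
  then show ?case
    using sine_prod_Suc_double_ge[of n] sine_prod_times_van_der_corput_ge_half[of n] by linarith
qed simp

text \<open>Even \<open>M\<close> doubles the bound 2. For odd M = 2n+1 the product is at least 4
  Q(n) x(n), which reaches 4 unless n is a power of two.\<close>

lemma sine_prod_ge_4:
  assumes "M \<ge> 3"
  shows "(\<exists>a. M = Suc (2 ^ a)) \<or> 4 \<le> sine_prod M"
proof (cases "even M")
  case True
  then obtain n where "M = 2 * n" by blast
  with assms show ?thesis
    using sine_prod_ge_2[of n] by (simp add: sine_prod_double)
next
  case False
  then obtain n where M: "M = Suc (2 * n)" by (auto elim: oddE)
  then have "n \<ge> 1" using assms by simp
  then consider a where "n = 2 ^ a" | "1 \<le> sine_prod n * van_der_corput n"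
    using sine_prod_times_van_der_corput_ge_1 by blast
  then show ?thesis
  proof cases
    case 1
    then have "M = Suc (2 ^ Suc a)" using M by simp
    then show ?thesis by blast
  next
    case 2
    then show ?thesis
      using sine_prod_Suc_double_ge[OF \<open>n \<ge> 1\<close>] M by simp
  qed
qed

lemma liminf_sine_prod: "liminf (\<lambda>N. ereal (sine_prod (Suc N))) = ereal pi"
proof (rule antisym)
  \<comment> \<open>The second argument of \<open>min\<close> interpolates the exceptional values
    Q(N+1) at N = 2^a. Capping it at 4 gives one minorant for both cases, with limit pi because pi <
    4.\<close>
  have "(\<lambda>N. min 4 (real N * (2 * sin (pi / (2 * real N))))) \<longlonglongrightarrow> min 4 pi"
    by (intro tendsto_min tendsto_const) real_asymp
  then have lim: "(\<lambda>N. ereal (min 4 (real N * (2 * sin (pi / (2 * real N)))))) \<longlonglongrightarrow> ereal pi"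
    using pi_less_4 by (simp add: min_def)
  have "\<forall>\<^sub>F N in sequentially.
      min 4 (real N * (2 * sin (pi / (2 * real N)))) \<le> sine_prod (Suc N)"
    using eventually_ge_at_top[of 2]
  proof eventually_elim
    case (elim N)
    then consider a where "N = 2 ^ a" | "4 \<le> sine_prod (Suc N)"
      using sine_prod_ge_4[of "Suc N"] by auto
    then show ?case
      by cases (auto simp: sine_prod_pow2_plus_1)
  qed
  then have "liminf (\<lambda>N. ereal (min 4 (real N * (2 * sin (pi / (2 * real N))))))
      \<le> liminf (\<lambda>N. ereal (sine_prod (Suc N)))"
    by (intro Liminf_mono) (simp only: ereal_less_eq)
  then show "ereal pi \<le> liminf (\<lambda>N. ereal (sine_prod (Suc N)))"
    using lim_imp_Liminf[OF _ lim] by simp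
next
  have sub: "strict_mono (\<lambda>a. 2 ^ a :: nat)"
    by (simp add: strict_mono_def)
  have "(\<lambda>a. 2 ^ a * (2 * sin (pi / (2 * 2 ^ a))) :: real) \<longlonglongrightarrow> pi"
    by real_asymp
  then have "(\<lambda>a. ereal (sine_prod (Suc (2 ^ a)))) \<longlonglongrightarrow> ereal pi"
    by (simp add: sine_prod_pow2_plus_1)
  from lim_imp_Liminf[OF _ this]
  show "liminf (\<lambda>N. ereal (sine_prod (Suc N))) \<le> ereal pi"
    using liminf_subseq_mono[OF sub, of "\<lambda>N. ereal (sine_prod (Suc N))"] by (simp add: o_def)
qed

section \<open>The upper limit\<close>

lemma sine_prod_Suc_double_le: "M \<ge> 1 \<Longrightarrow> sine_prod (Suc (2 * M)) \<le> 4 * sine_prod M"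
  using mult_left_mono[OF sin_le_one, of "4 * sine_prod M"]
  by (simp add: sine_prod_Suc_double sine_prod_nonneg)

text \<open>An odd step multiplies Q by at most 4, while M^2 grows by more than 4. The constant
  \<open>c\<close> is left open: it is 1/pi on the path 3, 7, 15, ... and 1/(2 pi) off it.\<close>

lemma sine_prod_Suc_double_quadratic:
  assumes "M \<ge> 1" "c \<ge> 0" "sine_prod M \<le> c * (real M)\<^sup>2"
  shows "sine_prod (Suc (2 * M)) \<le> c * (real (Suc (2 * M)))\<^sup>2"
proof -
  have "sine_prod (Suc (2 * M)) \<le> c * (2 * real M)\<^sup>2"
    using sine_prod_Suc_double_le[OF assms(1)] assms(3) by (simp add: power_mult_distrib)
  also have "\<dots> \<le> c * (real (Suc (2 * M)))\<^sup>2"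
    using assms(2) by (intro mult_left_mono power_mono) auto
  finally show ?thesis .
qed

lemma sine_prod_3_le: "sine_prod 3 \<le> 1 / pi * (real 3)\<^sup>2"
proof -
  have "sine_prod 3 = 2 * sqrt 2"
    using sine_prod_Suc_double[of 1] by (simp add: sine_prod_1 van_der_corput_1 sin_45)
  \<comment> \<open>The margin is slim, 2.828... against 9/pi = 2.864...; these roundings suffice
    since 3.15 * 2.83 = 8.9145 < 9.\<close>
  moreover have "sqrt 2 \<le> 1.415"
    by (rule real_le_lsqrt) (simp_all add: power2_eq_square)
  then have "pi * (2 * sqrt 2) \<le> 3.15 * (2 * 1.415)"
    using pi_approx by (intro mult_mono) auto
  ultimately show ?thesis
    by (simp add: field_simps)
qed

text \<open>The constant is twice the target 1/(2 pi), which is exactly what an even step off the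
  path can afford.\<close>

lemma sine_prod_pow2_minus_1_le: "sine_prod (2 ^ (m + 2) - 1) \<le> 1 / pi * (real (2 ^ (m + 2) - 1))\<^sup>2"
proof (induction m)
  case 0
  then show ?case using sine_prod_3_le by simp
next
  case (Suc m)
  have "(2::nat) ^ (m + 2) - 1 \<ge> 1"
    using pow2_Suc_minus_1[of "Suc m"] by simp
  from sine_prod_Suc_double_quadratic[OF this _ Suc]
  show ?case
    by (simp only: add_Suc pow2_Suc_minus_1) simp
qed

lemma sine_prod_pow2_plus_1_le: "sine_prod (Suc (2 ^ a)) \<le> pi"
proof -
  have "sin (pi / (2 * 2 ^ a)) \<le> pi / (2 * 2 ^ a)"
    by (intro sin_x_le_x) auto
  then show ?thesis
    by (simp add: sine_prod_pow2_plus_1 field_simps)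
qed

text \<open>The bound fails at 4, where Q(4) = 4 > 16/(2 pi); hence the start at 5. The induction
  hypothesis covers n >= 5, so the children of 2, 3 and 4 are checked directly.\<close>

lemma sine_prod_le:
  "M \<ge> 5 \<Longrightarrow> (\<exists>m\<ge>2. M = 2 ^ m - 1) \<or> sine_prod M \<le> 1 / (2 * pi) * (real M)\<^sup>2"
proof (induction M rule: nat_bit_induct)
  case (even n)
  have double: ?case if "sine_prod n \<le> 1 / pi * (real n)\<^sup>2"
  proof -
    have "sine_prod (2 * n) \<le> 1 / (2 * pi) * (real (2 * n))\<^sup>2"
      using that even.hyps sine_prod_double[of n] by (simp add: power_mult_distrib)
    then show ?thesis by blast
  qed
  consider "n = 3" | "n = 4" | "n \<ge> 5" using even by linarith
  then show ?case
  proof cases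
    case 1
    then show ?thesis using double sine_prod_3_le by simp
  next
    case 2
    have "sine_prod 4 = 4" using sine_prod_pow2[of 2] by simp
    then show ?thesis
      using double 2 pi_less_4 by (simp add: field_simps)
  next
    case 3
    from even.IH[OF this] show ?thesis
    proof
      assume "\<exists>m\<ge>2. n = 2 ^ m - 1"
      then obtain m where "n = 2 ^ (m + 2) - 1"
        by (metis add.commute le_Suc_ex)
      then show ?thesis using double sine_prod_pow2_minus_1_le[of m] by simp
    next
      assume "sine_prod n \<le> 1 / (2 * pi) * (real n)\<^sup>2"
      also have "\<dots> \<le> 1 / pi * (real n)\<^sup>2"
        by (intro mult_right_mono) (auto simp: field_simps)
      finally show ?thesis by (rule double)
    qed
  qed
next
  case (odd n)
  \<comment> \<open>Here M = 2^(a+1) + 1, so Q(M) <= pi, and pi^2 <= 10.24 < 25/2 with M >=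
    5.\<close>
  have small: ?case if "n = 2 ^ a" "a \<ge> 1" for a
  proof -
    have "pi * pi \<le> 3.2 * 3.2"
      using pi_approx by (intro mult_mono) auto
    then have "pi \<le> 1 / (2 * pi) * 5\<^sup>2"
      by (simp add: field_simps)
    also have "\<dots> \<le> 1 / (2 * pi) * (real (Suc (2 * n)))\<^sup>2"
      using odd.prems by (intro mult_left_mono power_mono) auto
    finally show ?thesis
      using sine_prod_pow2_plus_1_le[of "Suc a"] that by simp
  qed
  consider "n = 2" | "n = 3" | "n = 4" | "n \<ge> 5" using odd by linarith
  then show ?case
  proof cases
    case 1
    then show ?thesis using small[of 1] by simp
  next
    case 2
    then show ?thesis by (intro disjI1 exI[of _ 3]) simp
  next
    case 3
    then show ?thesis using small[of 2] by simp
  next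
    case 4
    from odd.IH[OF this] show ?thesis
    proof
      assume "\<exists>m\<ge>2. n = 2 ^ m - 1"
      then obtain m where "m \<ge> 2" "n = 2 ^ m - 1" by blast
      then have "Suc m \<ge> 2" "Suc (2 * n) = 2 ^ Suc m - 1"
        by (simp_all only: pow2_Suc_minus_1)
      then show ?thesis by blast
    next
      assume "sine_prod n \<le> 1 / (2 * pi) * (real n)\<^sup>2"
      then show ?thesis
        using sine_prod_Suc_double_quadratic[of n "1 / (2 * pi)"] 4 by simp
    qed
  qed
qed simp

lemma limsup_sine_prod:
  "limsup (\<lambda>N. ereal (1 / (real N)\<^sup>2 * sine_prod (Suc N))) = ereal (1 / (2 * pi))"
proof (rule antisym)
  \<comment> \<open>\<open>f\<close> is the generic bound at N+1 divided by N^2; \<open>g\<close>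
    interpolates the values on the path, where N + 1 = 2^m - 1 and so 2^m = N + 2.\<close>
  define f where "f = (\<lambda>x::real. (x + 1)\<^sup>2 / x\<^sup>2 / (2 * pi))"
  define g where "g = (\<lambda>x::real. (x + 2) / (2 * sin (pi / (x + 2))) / x\<^sup>2)"
  have "(\<lambda>N. f (real N)) \<longlonglongrightarrow> 1 / (2 * pi)"
    unfolding f_def by (real_asymp simp: field_simps)
  moreover have "(\<lambda>N. g (real N)) \<longlonglongrightarrow> 1 / (2 * pi)"
    unfolding g_def by (real_asymp simp: field_simps)
  ultimately have "(\<lambda>N. max (f (real N)) (g (real N))) \<longlonglongrightarrow> max (1 / (2 * pi)) (1 / (2 * pi))"
    by (rule tendsto_max)
  then have lim: "(\<lambda>N. ereal (max (f (real N)) (g (real N)))) \<longlonglongrightarrow> ereal (1 / (2 * pi))"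
    by (simp del: ereal_max)
  have "\<forall>\<^sub>F N in sequentially. 1 / (real N)\<^sup>2 * sine_prod (Suc N) \<le> max (f (real N)) (g (real N))"
    using eventually_ge_at_top[of 4]
  proof eventually_elim
    case (elim N)
    then consider m where "m \<ge> 2" "Suc N = 2 ^ m - 1"
      | "sine_prod (Suc N) \<le> 1 / (2 * pi) * (real (Suc N))\<^sup>2"
      using sine_prod_le[of "Suc N"] by auto
    then show ?case
    proof cases
      case 1
      then have "2 ^ m = N + 2" by simp
      then have "(2::real) ^ m = real N + 2"
        by (metis of_nat_add of_nat_numeral of_nat_power)
      then have "1 / (real N)\<^sup>2 * sine_prod (Suc N) = g (real N)"
        using 1 by (simp add: sine_prod_pow2_minus_1[unfolded One_nat_def] g_def)
      then show ?thesis by simp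
    next
      case 2
      then have "1 / (real N)\<^sup>2 * sine_prod (Suc N)
          \<le> 1 / (real N)\<^sup>2 * (1 / (2 * pi) * (real (Suc N))\<^sup>2)"
        by (intro mult_left_mono) auto
      also have "\<dots> = f (real N)"
        by (simp add: f_def add.commute)
      finally show ?thesis by simp
    qed
  qed
  then have "limsup (\<lambda>N. ereal (1 / (real N)\<^sup>2 * sine_prod (Suc N)))
      \<le> limsup (\<lambda>N. ereal (max (f (real N)) (g (real N))))"
    by (intro Limsup_mono) (simp only: ereal_less_eq)
  then show "limsup (\<lambda>N. ereal (1 / (real N)\<^sup>2 * sine_prod (Suc N))) \<le> ereal (1 / (2 * pi))"
    using lim_imp_Limsup[OF _ lim] by simp
next
  \<comment> \<open>The exponent starts at 1: under truncated subtraction 2^0 - 2 and 2^1 - 2 are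
    both 0, which would break strict monotonicity.\<close>
  define r where "r = (\<lambda>m. 2 ^ (m + 1) - 2 :: nat)"
  have sub: "strict_mono r"
    unfolding r_def by (rule strict_monoI_Suc) (simp add: diff_less_mono)
  have "(\<lambda>m. 1 / (2 ^ (m + 1) - 2)\<^sup>2 * (2 ^ (m + 1) / (2 * sin (pi / 2 ^ (m + 1)))) :: real)
      \<longlonglongrightarrow> 1 / (2 * pi)"
    by (real_asymp simp: field_simps)
  moreover have "1 / (real (r m))\<^sup>2 * sine_prod (Suc (r m))
      = 1 / (2 ^ (m + 1) - 2)\<^sup>2 * (2 ^ (m + 1) / (2 * sin (pi / 2 ^ (m + 1))))" for m
  proof -
    have "Suc (r m) = 2 ^ (m + 1) - 1" "real (r m) = 2 ^ (m + 1) - 2"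
      using pow2_Suc_minus_1[of m] by (simp_all add: r_def of_nat_diff diff_mult_distrib2)
    then show ?thesis
      using sine_prod_pow2_minus_1[of "m + 1"] by simp
  qed
  ultimately have "(\<lambda>m. ereal (1 / (real (r m))\<^sup>2 * sine_prod (Suc (r m)))) \<longlonglongrightarrow> ereal (1 / (2 * pi))"
    by simp
  from lim_imp_Limsup[OF _ this]
  show "ereal (1 / (2 * pi)) \<le> limsup (\<lambda>N. ereal (1 / (real N)\<^sup>2 * sine_prod (Suc N)))"
    using limsup_subseq_mono[OF sub, of "\<lambda>N. ereal (1 / (real N)\<^sup>2 * sine_prod (Suc N))"]
    by (simp add: o_def)
qed

theorem theorem5:
  "limsup (\<lambda>N. ereal (1 / (real N)\<^sup>2 * (\<Prod>n=1..N. \<bar>2 * sin (pi * van_der_corput n)\<bar>)))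
     = ereal (1 / (2 * pi)) \<and>
   liminf (\<lambda>N. ereal (\<Prod>n=1..N. \<bar>2 * sin (pi * van_der_corput n)\<bar>)) = ereal pi"
  using limsup_sine_prod liminf_sine_prod
  by (simp add: sine_prod_def atLeastLessThanSuc_atLeastAtMost)

end
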